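(* There exists a directed graph $\overleftarrow{G}$ of cardinality $\mathfrak{c}$, unique up to isomorphism, such that: (i) for any countable set $A\subseteq\overleftarrow{G}$ there exist $\mathfrak{c}$-many $g\in\overleftarrow{G}$ such that $A=\{a\in\overleftarrow{G} : (g,a)\in E(\overleftarrow{G})\}$; (ii) for any $g\in\overleftarrow{G}$, the set $\{a\in\overleftarrow{G} : (g,a)\in E(\overleftarrow{G})\}$ is countable; (iii) $\overleftarrow{G}$ embeds into every directed graph satisfying properties (i) and (ii).
   Context: Work in ZFC; $\mathfrak{c}=2^{\aleph_0}$. "Countable" means finite (possibly empty) or countably infinite. A directed graph is identified with its vertex set, and $E(\overleftarrow{G})$ is its set of arrows (ordered pairs of vertices). An embedding of directed graphs is an injective map $\phi$ on vertices such that $(a,b)$ is an arrow if and only if $(\phi(a),\phi(b))$ is an arrow. *)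

theory Defs
  imports
    "Graph_Theory.Graph_Theory"
    "HOL-Library.Countable_Set"
    "HOL-Library.Equipollence"
begin

text \<open>
  A directed graph is a \<^typ>\<open>'a pair_pre_digraph\<close> satisfying \<^locale>\<open>pair_wf_digraph\<close>:
  a vertex set \<^const>\<open>pverts\<close> of arbitrary cardinality and a set \<^const>\<open>parcs\<close> of ordered
  pairs of vertices. Loops are allowed.
\<close>

abbreviation continuum :: "nat set set"
  where "continuum \<equiv> UNIV"

definition out_nbs :: "'a pair_pre_digraph \<Rightarrow> 'a \<Rightarrow> 'a set"
  where "out_nbs G g = {a \<in> pverts G. (g, a) \<in> parcs G}"

definition realizes_countable_sets :: "'a pair_pre_digraph \<Rightarrow> bool"
  where "realizes_countable_sets G \<longleftrightarrow>
    (\<forall>A \<subseteq> pverts G. countable A \<longrightarrow>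
      continuum \<lesssim> {g \<in> pverts G. A = out_nbs G g})"

definition countable_out_nbs :: "'a pair_pre_digraph \<Rightarrow> bool"
  where "countable_out_nbs G \<longleftrightarrow> (\<forall>g \<in> pverts G. countable (out_nbs G g))"

definition digraph_embedding ::
    "('a \<Rightarrow> 'b) \<Rightarrow> 'a pair_pre_digraph \<Rightarrow> 'b pair_pre_digraph \<Rightarrow> bool"
  where "digraph_embedding \<phi> G H \<longleftrightarrow>
    \<phi> \<in> pverts G \<rightarrow> pverts H \<and> inj_on \<phi> (pverts G) \<and>
    (\<forall>a \<in> pverts G. \<forall>b \<in> pverts G. (a, b) \<in> parcs G \<longleftrightarrow> (\<phi> a, \<phi> b) \<in> parcs H)"

text \<open>
  HOL cannot quantify over types inside a formula, so the type \<open>'b\<close> from which the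
  target graphs take their vertices is an explicit argument.
\<close>

definition embeds_into_all :: "'b itself \<Rightarrow> 'a pair_pre_digraph \<Rightarrow> bool"
  where "embeds_into_all _ G \<longleftrightarrow>
    (\<forall>H :: 'b pair_pre_digraph.
      pair_wf_digraph H \<and> realizes_countable_sets H \<and> countable_out_nbs H \<longrightarrow>
      (\<exists>\<phi>. digraph_embedding \<phi> G H))"

text \<open>
  In the theorem, \<open>'b\<close> and \<open>'c\<close> are free and hence range over all types. Since the
  existential quantifier stands inside the quantification over \<open>'b\<close> and \<open>'c\<close>, the graph
  might seem to depend on them. It does not: it also embeds into all suitable graphs over the
  fixed type \<^typ>\<open>nat set\<close>, and the uniqueness clause assumes of the competitor \<open>G'\<close> only
  this instance of universality. Taking \<open>'c\<close> to be \<^typ>\<open>nat set\<close> shows that the graphs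
  obtained for different \<open>'b\<close> are all isomorphic, so that one graph serves every \<open>'b\<close>.
  A graph of cardinality continuum always has a copy with vertices in \<^typ>\<open>nat set\<close>.
\<close>

end

theory Submission
  imports Defs "HOL-Library.Countable_Set_Type"
begin

text \<open>
  The graph is the one of well-founded trees whose nodes carry a label from the continuum and have
  a countable set of subtrees, the arrows leading from a tree to its immediate subtrees. It is
  well-founded, and its vertices with a prescribed out-neighbourhood correspond to the labels. A
  map out of a well-founded graph can be defined recursively: a vertex with out-neighbourhood
  \<open>A\<close> is sent into the fibre over the image of \<open>A\<close>. Fibrewise injections yield an embedding, and
  fibrewise bijections an isomorphism. A competitor embeds into the tree graph, so it is
  well-founded as well, and the fibres of both graphs have size continuum.
\<close>

section \<open>Recursion along well-founded digraphs\<close>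

abbreviation fibre :: "'a pair_pre_digraph \<Rightarrow> 'a set \<Rightarrow> 'a set"
  where "fibre G A \<equiv> {g \<in> pverts G. A = out_nbs G g}"

lemma out_nbs_subset: "out_nbs G g \<subseteq> pverts G"
  by (auto simp: out_nbs_def)

text \<open>An infinite directed path in \<open>G\<close> would be carried to one in
  \<open>H\<close>; the converse makes out-neighbours the smaller elements. Properties (i) and (ii)
  alone allow loops, so this is how a universal competitor becomes well-founded.\<close>

lemma wf_digraph_embedding:
  assumes "pair_wf_digraph G" and "digraph_embedding \<phi> G H" and "wf ((parcs H)\<inverse>)"
  shows "wf ((parcs G)\<inverse>)"
proof (rule wf_subset)
  show "wf (inv_image ((parcs H)\<inverse>) \<phi>)"
    using assms(3) by (rule wf_inv_image)
  show "(parcs G)\<inverse> \<subseteq> inv_image ((parcs H)\<inverse>) \<phi>"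
  proof (clarsimp)
    fix g a assume ga: "(g, a) \<in> parcs G"
    then have "g \<in> pverts G" "a \<in> pverts G"
      using pair_wf_digraph.arc_fst_in_verts[OF assms(1)]
        pair_wf_digraph.arc_snd_in_verts[OF assms(1)] by fastforce+
    with ga show "(\<phi> g, \<phi> a) \<in> parcs H"
      using assms(2) by (simp add: digraph_embedding_def)
  qed
qed

text \<open>The recursion forces \<open>out_nbs H (\<phi> g)\<close> to be the image of
  \<open>out_nbs G g\<close>; together with injectivity, this preserves and reflects arrows. The
  recursion equation is kept in the conclusion because surjectivity is later derived from
  it.\<close>

lemma fibrewise_recursion:
  fixes G :: "'a pair_pre_digraph" and H :: "'b pair_pre_digraph"
  assumes wf: "wf ((parcs G)\<inverse>)" and count: "countable_out_nbs G"
    and f: "\<And>A B. \<lbrakk>A \<subseteq> pverts G; countable A; B \<subseteq> pverts H; countable B\<rbrakk>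
      \<Longrightarrow> inj_on (f A B) (fibre G A) \<and> f A B ` fibre G A \<subseteq> fibre H B"
  shows "\<exists>\<phi>. digraph_embedding \<phi> G H \<and>
    (\<forall>g \<in> pverts G. \<phi> g = f (out_nbs G g) (\<phi> ` out_nbs G g) g)"
proof -
  define \<phi> where
    "\<phi> \<equiv> wfrec ((parcs G)\<inverse>) (\<lambda>\<psi> g. f (out_nbs G g) (\<psi> ` out_nbs G g) g)"
  have \<phi>_eq: "\<phi> g = f (out_nbs G g) (\<phi> ` out_nbs G g) g" for g
  proof -
    \<comment> \<open>\<open>wfrec\<close> supplies recursive values only below \<open>g\<close>,
      and these are the values on out-neighbours, so the truncation does not alter the
      image.\<close>
    have "cut \<phi> ((parcs G)\<inverse>) g ` out_nbs G g = \<phi> ` out_nbs G g"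
      by (rule image_cong) (auto simp: out_nbs_def cut_apply)
    then show ?thesis
      unfolding def_wfrec[OF \<phi>_def wf, of g] by simp
  qed
  have countable_image: "countable (out_nbs G g)" "countable (\<phi> ` out_nbs G g)"
    if "g \<in> pverts G" for g
    using that count by (auto simp: countable_out_nbs_def)
  have fibre: "\<phi> g \<in> fibre H (\<phi> ` out_nbs G g)" if "g \<in> pverts G" for g
    using wf that
  proof (induction g rule: wf_induct_rule)
    case (less g)
    have "\<phi> ` out_nbs G g \<subseteq> pverts H"
      using less.IH by (auto simp: out_nbs_def)
    with f[OF out_nbs_subset, of g "\<phi> ` out_nbs G g"] countable_image[OF less.prems]
    have "f (out_nbs G g) (\<phi> ` out_nbs G g) ` fibre G (out_nbs G g) \<subseteq> fibre H (\<phi> ` out_nbs G g)"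
      by simp
    moreover have "g \<in> fibre G (out_nbs G g)"
      using less.prems by simp
    ultimately have "f (out_nbs G g) (\<phi> ` out_nbs G g) g \<in> fibre H (\<phi> ` out_nbs G g)"
      by (meson image_subset_iff)
    then show ?case
      using \<phi>_eq[of g] by simp
  qed
  \<comment> \<open>Equal values have equal out-neighbourhoods in \<open>H\<close>. The induction
    hypothesis, with the second vertex arbitrary, pulls this back to \<open>G\<close>, so
    \<open>g\<close> and \<open>g'\<close> lie in one fibre, on which a single injection
    \<open>f A B\<close> acts.\<close>
  have inj: "g = g'" if "g \<in> pverts G" "g' \<in> pverts G" "\<phi> g = \<phi> g'" for g g'
    using wf that
  proof (induction g arbitrary: g' rule: wf_induct_rule)
    case (less g)
    have img: "\<phi> ` out_nbs G g = \<phi> ` out_nbs G g'"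
      using fibre[OF less.prems(1)] fibre[OF less.prems(2)] less.prems(3) by auto
    have IH: "a = a'" if "a \<in> out_nbs G g" "a' \<in> out_nbs G g'" "\<phi> a = \<phi> a'" for a a'
      using that less.IH by (auto simp: out_nbs_def)
    have out: "out_nbs G g = out_nbs G g'"
    proof (intro equalityI subsetI)
      fix a assume a: "a \<in> out_nbs G g"
      then have "\<phi> a \<in> \<phi> ` out_nbs G g'"
        unfolding img[symmetric] by (rule imageI)
      then obtain a' where "a' \<in> out_nbs G g'" "\<phi> a = \<phi> a'"
        by (elim imageE)
      with IH[OF a] show "a \<in> out_nbs G g'"
        by simp
    next
      fix a' assume a': "a' \<in> out_nbs G g'"
      then have "\<phi> a' \<in> \<phi> ` out_nbs G g"
        unfolding img by (rule imageI)
      then obtain a where a: "a \<in> out_nbs G g" "\<phi> a' = \<phi> a"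
        by (elim imageE)
      with IH[OF a(1) a'] show "a' \<in> out_nbs G g"
        by simp
    qed
    have "\<phi> ` out_nbs G g \<subseteq> pverts H"
      using fibre by (auto simp: out_nbs_def)
    then have "inj_on (f (out_nbs G g) (\<phi> ` out_nbs G g)) (fibre G (out_nbs G g))"
      using f[OF out_nbs_subset, of g "\<phi> ` out_nbs G g"] countable_image[OF less.prems(1)] by simp
    moreover have "f (out_nbs G g) (\<phi> ` out_nbs G g) g = f (out_nbs G g) (\<phi> ` out_nbs G g) g'"
      using less.prems(3) by (subst (asm) (1 2) \<phi>_eq) (simp only: out)
    ultimately show ?case
      using less.prems out by (auto dest: inj_onD)
  qed
  have out: "out_nbs H (\<phi> g) = \<phi> ` out_nbs G g" if "g \<in> pverts G" for g
    using fibre[OF that] by auto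
  have arc: "(a, b) \<in> parcs G \<longleftrightarrow> (\<phi> a, \<phi> b) \<in> parcs H"
    if "a \<in> pverts G" "b \<in> pverts G" for a b
  proof -
    have "(\<phi> a, \<phi> b) \<in> parcs H \<longleftrightarrow> \<phi> b \<in> out_nbs H (\<phi> a)"
      using fibre that by (auto simp: out_nbs_def)
    also have "\<dots> \<longleftrightarrow> b \<in> out_nbs G a"
      using out[OF that(1)] inj that out_nbs_subset[of G a] by blast
    finally show ?thesis
      using that by (simp add: out_nbs_def)
  qed
  show ?thesis
  proof (intro exI conjI ballI)
    show "digraph_embedding \<phi> G H"
      using fibre inj arc by (auto simp: digraph_embedding_def intro!: inj_onI)
  qed (rule \<phi>_eq)
qed

text \<open>A fibre of \<open>G\<close> has size at most continuum, and a fibre of \<open>H\<close>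
  over a countable set has at least that size, so fibrewise injections exist. The recursion runs
  along \<open>G\<close> only, hence the lemma reaches targets \<open>H\<close> with loops or
  infinite paths.\<close>

lemma well_founded_embeds:
  fixes G :: "'a pair_pre_digraph" and H :: "'b pair_pre_digraph"
  assumes "wf ((parcs G)\<inverse>)" "countable_out_nbs G" "pverts G \<lesssim> continuum"
    and "realizes_countable_sets H"
  shows "\<exists>\<phi>. digraph_embedding \<phi> G H"
proof -
  have "\<exists>k. inj_on k (fibre G A) \<and> k ` fibre G A \<subseteq> fibre H B"
    if "B \<subseteq> pverts H" "countable B" for A B
  proof -
    have "fibre G A \<lesssim> pverts G"
      by (rule subset_imp_lepoll) auto
    also have "\<dots> \<lesssim> continuum"
      by fact
    also have "\<dots> \<lesssim> fibre H B"
      using assms(4) that by (simp add: realizes_countable_sets_def)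
    finally show ?thesis
      by (simp add: lepoll_def)
  qed
  note injection = someI_ex[OF this]
  \<comment> \<open>The recursion takes the injections as one function of \<open>A\<close> and
    \<open>B\<close>, so one is chosen in advance for each pair.\<close>
  define f where "f A B = (SOME k. inj_on k (fibre G A) \<and> k ` fibre G A \<subseteq> fibre H B)" for A B
  have f: "inj_on (f A B) (fibre G A) \<and> f A B ` fibre G A \<subseteq> fibre H B"
    if "A \<subseteq> pverts G" "countable A" "B \<subseteq> pverts H" "countable B" for A B
    unfolding f_def by (rule injection) (use that in auto)
  have "\<exists>\<phi>. digraph_embedding \<phi> G H \<and>
      (\<forall>g \<in> pverts G. \<phi> g = f (out_nbs G g) (\<phi> ` out_nbs G g) g)"
    by (rule fibrewise_recursion[OF assms(1,2) f])
  then show ?thesis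
    by blast
qed

section \<open>Isomorphisms between well-founded digraphs\<close>

lemma digraph_iso_of_embedding:
  assumes "pair_wf_digraph G" "pair_wf_digraph H"
    and emb: "digraph_embedding \<phi> G H" and surj: "pverts H \<subseteq> \<phi> ` pverts G"
  shows "digraph_iso (with_proj G) (with_proj H)"
proof -
  \<comment> \<open>An isomorphism also acts on arcs. Arcs are pairs here, so \<open>\<phi>\<close>
    is applied to both components, with the projections of \<open>with_proj\<close> as tail and
    head.\<close>
  let ?F = "\<lparr>iso_verts = \<phi>, iso_arcs = map_prod \<phi> \<phi>, iso_head = snd, iso_tail = fst\<rparr>"
  have G: "parcs G \<subseteq> pverts G \<times> pverts G" and H: "parcs H \<subseteq> pverts H \<times> pverts H"
    using assms(1,2) unfolding pair_wf_digraph_def by fastforce+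
  have inj: "inj_on \<phi> (pverts G)" and verts: "\<phi> ` pverts G = pverts H"
    and arc: "\<And>a b. \<lbrakk>a \<in> pverts G; b \<in> pverts G\<rbrakk>
      \<Longrightarrow> (a, b) \<in> parcs G \<longleftrightarrow> (\<phi> a, \<phi> b) \<in> parcs H"
    using emb surj by (auto simp: digraph_embedding_def)
  have "inj_on (map_prod \<phi> \<phi>) (parcs G)"
    using map_prod_inj_on[OF inj inj] G by (rule inj_on_subset)
  moreover have "wf_digraph (with_proj G)"
    using G by unfold_locales auto
  ultimately have "pre_digraph.digraph_isomorphism (with_proj G) ?F"
    using inj by (auto simp: pre_digraph.digraph_isomorphism_def)
  moreover have "map_prod \<phi> \<phi> ` parcs G = parcs H"
  proof (intro equalityI subsetI)
    fix e assume "e \<in> map_prod \<phi> \<phi> ` parcs G"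
    then show "e \<in> parcs H"
      using G arc by auto
  next
    fix e assume e: "e \<in> parcs H"
    then obtain a b where "e = (\<phi> a, \<phi> b)" "a \<in> pverts G" "b \<in> pverts G"
      using H verts by blast
    then show "e \<in> map_prod \<phi> \<phi> ` parcs G"
      using arc e by force
  qed
  then have "with_proj H = app_iso ?F (with_proj G)"
    using verts by (simp add: with_proj_def app_iso_def)
  ultimately show ?thesis
    unfolding digraph_iso_def by blast
qed

lemma fibre_eqpoll_continuum:
  assumes "pverts G \<lesssim> continuum" "realizes_countable_sets G" "A \<subseteq> pverts G" "countable A"
  shows "fibre G A \<approx> continuum"
proof (rule lepoll_antisym)
  have "fibre G A \<lesssim> pverts G"
    by (rule subset_imp_lepoll) auto
  then show "fibre G A \<lesssim> continuum"
    using assms(1) by (rule lepoll_trans)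
  show "continuum \<lesssim> fibre G A"
    using assms(2-4) by (simp add: realizes_countable_sets_def)
qed

text \<open>All fibres over countable sets have size exactly continuum, so the recursion can use
  bijections. Surjectivity then follows by induction along \<open>H\<close>.\<close>

lemma well_founded_iso:
  fixes G :: "'a pair_pre_digraph" and H :: "'b pair_pre_digraph"
  assumes wfG: "pair_wf_digraph G" "wf ((parcs G)\<inverse>)" "pverts G \<lesssim> continuum"
      "realizes_countable_sets G" "countable_out_nbs G"
    and wfH: "pair_wf_digraph H" "wf ((parcs H)\<inverse>)" "pverts H \<lesssim> continuum"
      "realizes_countable_sets H" "countable_out_nbs H"
  shows "digraph_iso (with_proj G) (with_proj H)"
proof -
  have "\<exists>k. bij_betw k (fibre G A) (fibre H B)"
    if "A \<subseteq> pverts G" "countable A" "B \<subseteq> pverts H" "countable B" for A B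
    using eqpoll_trans[OF fibre_eqpoll_continuum eqpoll_sym[OF fibre_eqpoll_continuum]] assms that
    unfolding eqpoll_def by blast
  note bijection = someI_ex[OF this]
  define f where "f A B = (SOME k. bij_betw k (fibre G A) (fibre H B))" for A B
  have f: "bij_betw (f A B) (fibre G A) (fibre H B)"
    if "A \<subseteq> pverts G" "countable A" "B \<subseteq> pverts H" "countable B" for A B
    unfolding f_def by (rule bijection) (use that in auto)
  then have f_into: "\<And>A B. \<lbrakk>A \<subseteq> pverts G; countable A; B \<subseteq> pverts H; countable B\<rbrakk>
      \<Longrightarrow> inj_on (f A B) (fibre G A) \<and> f A B ` fibre G A \<subseteq> fibre H B"
    by (simp add: bij_betw_def)
  have "\<exists>\<phi>. digraph_embedding \<phi> G H \<and>
      (\<forall>g \<in> pverts G. \<phi> g = f (out_nbs G g) (\<phi> ` out_nbs G g) g)"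
    by (rule fibrewise_recursion[OF wfG(2,5) f_into])
  then obtain \<phi> where emb: "digraph_embedding \<phi> G H"
    and \<phi>_eq: "\<And>g. g \<in> pverts G \<Longrightarrow> \<phi> g = f (out_nbs G g) (\<phi> ` out_nbs G g) g"
    by blast
  have "h \<in> \<phi> ` pverts G" if "h \<in> pverts H" for h
    using wfH(2) that
  proof (induction h rule: wf_induct_rule)
    case (less h)
    \<comment> \<open>By induction \<open>\<phi>\<close> hits every out-neighbour of
      \<open>h\<close>, so \<open>A\<close> maps onto \<open>out_nbs H h\<close>. The bijection
      between the fibres over these two sets yields a \<open>g\<close> with value \<open>h\<close>,
      and as \<open>out_nbs G g = A\<close>, this is the bijection that defines
      \<open>\<phi> g\<close>.\<close>
    define A where "A = {a \<in> pverts G. \<phi> a \<in> out_nbs H h}"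
    have img: "\<phi> ` A = out_nbs H h"
      using less.IH by (fastforce simp: A_def out_nbs_def)
    have count: "countable (out_nbs H h)"
      using wfH(5) less.prems by (simp add: countable_out_nbs_def)
    have A: "A \<subseteq> pverts G" and "inj_on \<phi> A"
      using emb by (auto simp: A_def digraph_embedding_def inj_on_def)
    then have "countable A"
      using count img by (metis countable_image_inj_on)
    then have onto: "f A (out_nbs H h) ` fibre G A = fibre H (out_nbs H h)"
      by (intro bij_betw_imp_surj_on f A count out_nbs_subset)
    have "h \<in> f A (out_nbs H h) ` fibre G A"
      unfolding onto using less.prems by simp
    then obtain g where g: "g \<in> fibre G A" and h: "h = f A (out_nbs H h) g"
      by (elim imageE)
    have "\<phi> g = f A (out_nbs H h) g"
      using \<phi>_eq[of g] g img by simp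
    with g h show ?case
      by auto
  qed
  then show ?thesis
    using digraph_iso_of_embedding[OF wfG(1) wfH(1) emb] by blast
qed

section \<open>The graph of countably branching trees\<close>

datatype ctree = Node (label: "nat set") (subtrees: "ctree cset")

text \<open>
  The code of a tree lists its labels along all addresses. Every code contains \<open>([], None)\<close>, so
  the dummy element \<open>{}\<close> makes the set of codes to be enumerated nonempty without hiding any code.
\<close>

primrec code :: "ctree \<Rightarrow> (nat list \<times> nat option) set" where
  "code (Node r A) = insert ([], None) (Pair [] ` Some ` r) \<union>
    {(n # l, x) | n l x. (l, x) \<in> from_nat_into (insert {} (rcset (cimage code A))) n}"

text \<open>The label is read off at the address \<open>[]\<close>, and the entry \<open>n\<close>
  of the enumeration from the addresses beginning with \<open>n\<close>. The enumeration may repeat,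
  but its range is the set of child codes with \<open>{}\<close> added; since \<open>{}\<close> is
  no code, it can be removed, and the induction hypothesis identifies the children.\<close>

lemma code_inject: "code s = code t \<Longrightarrow> s = t"
proof (induction s arbitrary: t)
  case (Node r A)
  obtain r' A' where t: "t = Node r' A'"
    by (cases t)
  define D where "D A = insert {} (rcset (cimage code A))" for A
  have nonempty: "{} \<notin> code ` X" for X
  proof
    assume "{} \<in> code ` X"
    then obtain u where "code u = {}" by auto
    then show False by (cases u) auto
  qed
  have root: "k \<in> r \<longleftrightarrow> ([], Some k) \<in> code (Node r A)" for k r A
    by auto
  have child: "from_nat_into (D A) n = {(l, x). (n # l, x) \<in> code (Node r A)}" for n r A
    by (auto simp: D_def)
  have eq: "code (Node r A) = code (Node r' A')"
    using Node.prems t by simp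
  have "r = r'"
    by (rule set_eqI) (simp only: root[of _ r A] root[of _ r' A'] eq)
  have "from_nat_into (D A) = from_nat_into (D A')"
    by (rule ext) (simp only: child[of A _ r] child[of A' _ r'] eq)
  moreover have "range (from_nat_into (D B)) = D B" for B
    by (rule range_from_nat_into) (simp_all add: D_def)
  ultimately have "D A = D A'"
    by metis
  then have codes: "code ` rcset A = code ` rcset A'"
    unfolding D_def cimage.rep_eq by (rule iffD1[OF insert_ident[OF nonempty nonempty]])
  have "rcset A = rcset A'"
  proof (intro equalityI subsetI)
    fix a assume a: "a \<in> rcset A"
    then have "code a \<in> code ` rcset A'"
      unfolding codes[symmetric] by (rule imageI)
    then obtain a' where "a' \<in> rcset A'" "code a = code a'"
      by (elim imageE)
    with Node.IH[of a a'] a show "a \<in> rcset A'"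
      by (simp add: cin.rep_eq)
  next
    fix a' assume a': "a' \<in> rcset A'"
    then have "code a' \<in> code ` rcset A"
      unfolding codes by (rule imageI)
    then obtain a where "a \<in> rcset A" "code a' = code a"
      by (elim imageE)
    with Node.IH[of a a'] a' show "a' \<in> rcset A"
      by (simp add: cin.rep_eq)
  qed
  then show ?case
    using \<open>r = r'\<close> t by (simp add: rcset_inject)
qed

text \<open>There are countably many pairs of an address and an optional label, so a code becomes a
  set of naturals. This bounds the number of trees by the continuum.\<close>

definition tree_code :: "ctree \<Rightarrow> nat set"
  where "tree_code t = to_nat ` code t"

lemma inj_tree_code: "inj tree_code"
  unfolding tree_code_def
  by (rule injI, rule code_inject, rule iffD1[OF inj_image_eq_iff[OF inj_to_nat]])

section \<open>Properties of the digraph of trees\<close>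

definition tree_digraph :: "nat set pair_pre_digraph"
  where "tree_digraph = \<lparr>pverts = range tree_code,
    parcs = {(tree_code t, tree_code s) | s t. s \<in> rcset (subtrees t)}\<rparr>"

lemma out_nbs_tree_digraph: "out_nbs tree_digraph (tree_code t) = tree_code ` rcset (subtrees t)"
  by (auto simp: out_nbs_def tree_digraph_def inj_eq[OF inj_tree_code])

lemma pair_wf_tree_digraph: "pair_wf_digraph tree_digraph"
  by unfold_locales (auto simp: tree_digraph_def)

lemma wf_tree_digraph: "wf ((parcs tree_digraph)\<inverse>)"
proof (rule wfUNIVI)
  fix P x
  assume step: "\<forall>x. (\<forall>y. (y, x) \<in> (parcs tree_digraph)\<inverse> \<longrightarrow> P y) \<longrightarrow> P x"
  have tree: "P (tree_code t)" for t
  proof (induction t)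
    case (Node r A)
    show ?case
    proof (rule step[rule_format])
      fix y assume "(y, tree_code (Node r A)) \<in> (parcs tree_digraph)\<inverse>"
      then obtain s where "s \<in> rcset A" "y = tree_code s"
        by (auto simp: tree_digraph_def inj_eq[OF inj_tree_code])
      then show "P y"
        using Node.IH by (simp add: cin.rep_eq)
    qed
  qed
  \<comment> \<open>\<open>x\<close> itself need not be a code, but every arrow from it ends in one,
    so the structural induction covers all its out-neighbours.\<close>
  show "P x"
    by (rule step[rule_format]) (auto simp: tree_digraph_def tree)
qed

lemma countable_out_nbs_tree_digraph: "countable_out_nbs tree_digraph"
proof -
  have "pverts tree_digraph = range tree_code"
    by (simp add: tree_digraph_def)
  then show ?thesis
    by (auto simp: countable_out_nbs_def out_nbs_tree_digraph)
qed

lemma realizes_tree_digraph: "realizes_countable_sets tree_digraph"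
  unfolding realizes_countable_sets_def
proof (intro allI impI)
  fix A assume "A \<subseteq> pverts tree_digraph" "countable A"
  then obtain T where T: "countable T" "A = tree_code ` T"
    using countable_subset_image[of A tree_code UNIV] unfolding tree_digraph_def by auto
  \<comment> \<open>The set of subtrees stays fixed while the label runs through the continuum;
    \<open>acset T\<close> has the elements of \<open>T\<close> because \<open>T\<close> is
    countable.\<close>
  let ?k = "\<lambda>r. tree_code (Node r (acset T))"
  have "inj ?k"
    by (auto simp: inj_def inj_eq[OF inj_tree_code])
  moreover have "range ?k \<subseteq> fibre tree_digraph A"
    using T by (auto simp: out_nbs_tree_digraph) (auto simp: tree_digraph_def)
  ultimately show "continuum \<lesssim> fibre tree_digraph A"
    unfolding lepoll_def by blast
qed

text \<open>The vertex type gives the upper bound, the leaves (the fibre over the empty set) the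
  lower one.\<close>

lemma tree_digraph_eqpoll: "pverts tree_digraph \<approx> continuum"
proof (rule lepoll_antisym)
  show "pverts tree_digraph \<lesssim> continuum"
    by (rule subset_imp_lepoll) simp
  have "continuum \<lesssim> fibre tree_digraph {}"
    using realizes_tree_digraph by (simp add: realizes_countable_sets_def)
  also have "\<dots> \<lesssim> pverts tree_digraph"
    by (rule subset_imp_lepoll) auto
  finally show "continuum \<lesssim> pverts tree_digraph" .
qed

lemma embeds_tree_digraph: "embeds_into_all TYPE('b) tree_digraph"
  unfolding embeds_into_all_def
  by (intro allI impI well_founded_embeds wf_tree_digraph countable_out_nbs_tree_digraph
      eqpoll_imp_lepoll[OF tree_digraph_eqpoll]) simp

theorem theorem3:
  shows "\<exists>G :: nat set pair_pre_digraph.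
    pair_wf_digraph G \<and> pverts G \<approx> continuum \<and>
    realizes_countable_sets G \<and> countable_out_nbs G \<and>
    embeds_into_all TYPE(nat set) G \<and> embeds_into_all TYPE('b) G \<and>
    (\<forall>G' :: 'c pair_pre_digraph.
      pair_wf_digraph G' \<and> pverts G' \<approx> continuum \<and>
      realizes_countable_sets G' \<and> countable_out_nbs G' \<and>
      embeds_into_all TYPE(nat set) G' \<longrightarrow>
      digraph_iso (with_proj G) (with_proj G'))"
proof (intro exI[of _ tree_digraph] conjI allI impI)
  fix G' :: "'c pair_pre_digraph"
  assume G': "pair_wf_digraph G' \<and> pverts G' \<approx> continuum \<and>
    realizes_countable_sets G' \<and> countable_out_nbs G' \<and> embeds_into_all TYPE(nat set) G'"
  \<comment> \<open>\<open>tree_digraph\<close> is itself a suitable target over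
    \<open>nat set\<close>, so the universality assumed of \<open>G'\<close> applies to it.\<close>
  then obtain \<phi> where "digraph_embedding \<phi> G' tree_digraph"
    unfolding embeds_into_all_def
    using pair_wf_tree_digraph realizes_tree_digraph countable_out_nbs_tree_digraph by blast
  with G' have "wf ((parcs G')\<inverse>)"
    using wf_digraph_embedding wf_tree_digraph by blast
  with G' show "digraph_iso (with_proj tree_digraph) (with_proj G')"
    by (intro well_founded_iso pair_wf_tree_digraph wf_tree_digraph realizes_tree_digraph
        countable_out_nbs_tree_digraph eqpoll_imp_lepoll[OF tree_digraph_eqpoll])
      (auto intro: eqpoll_imp_lepoll)
qed (rule pair_wf_tree_digraph tree_digraph_eqpoll realizes_tree_digraph
    countable_out_nbs_tree_digraph embeds_tree_digraph)+

end
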